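(* Let $(f_n)_{n\ge 0}$ be any base-$3/2$ sorted Fibs sequence whose two starting terms $f_0,f_1$ are sorted and not both zero. Then the sequence eventually turns into either the Pinocchio sequence or the 3-cycle $112, 1122, 1122$. That is, either there exist $N,K\ge 0$ such that $f_{N+i}=p_{K+i}$ for all $i\ge 0$, where $(p_n)_{n\ge 0}$ is the Pinocchio sequence, or there exists $N\ge 0$ such that $f_{N+3i}=112$ and $f_{N+3i+1}=f_{N+3i+2}=1122$ for all $i\ge 0$.
   Context: Numbers are written as finite strings of digits $0,1,2$ in base $3/2$ (leading zeros are dropped; the number $0$ corresponds to the string with no nonzero digits). Strings need not represent integers. Addition in base $3/2$: right-align the two strings, add digitwise, then carry: as long as some digit is at least $3$, subtract $3$ from it and add $2$ to the digit immediately to its left, until all digits are in $\{0,1,2\}$. The result does not depend on the order of the carries. A string is sorted if its digits are in nondecreasing order from left to right; after dropping leading zeros it consists of some number (possibly none) of $1$s followed by some number (possibly none) of $2$s. A (base-$3/2$) sorted Fibs sequence $(f_n)_{n\ge0}$ is defined by two starting terms $f_0,f_1$ and, for $n\ge 1$, $f_{n+1}$ is obtained by adding $f_{n-1}$ and $f_n$ in base $3/2$ and sorting the digits of the result in increasing order (so zeros go to the front and disappear). The Pinocchio sequence $(p_n)_{n\ge 0}$ is the sorted Fibs sequence with $p_0=0$, $p_1=1$; it begins $0,1,1,2,2,12,12,112,112,1112,1112,11112,\ldots$. *)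

theory Defs
  imports Main
begin

text \<open>
  Digit strings are lists of naturals written as usual, most significant digit first.
  A number is represented by its string without leading zeros, so zero is the empty list.
\<close>

definition numeral32 :: "nat list \<Rightarrow> bool" where
  "numeral32 ds \<longleftrightarrow> set ds \<subseteq> {0, 1, 2} \<and> (ds \<noteq> [] \<longrightarrow> hd ds \<noteq> 0)"

definition drop_zeros :: "nat list \<Rightarrow> nat list" where
  "drop_zeros ds = dropWhile (\<lambda>d. d = 0) ds"

definition pad :: "nat \<Rightarrow> nat list \<Rightarrow> nat list" where
  "pad n ds = replicate (n - length ds) 0 @ ds"

definition digitwise_add :: "nat list \<Rightarrow> nat list \<Rightarrow> nat list" where
  "digitwise_add xs ys = map2 (+) (pad (length ys) xs) (pad (length xs) ys)"

text \<open>A single carry. In the second rule the digit to the left is an implicit leading zero.\<close>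

inductive carry_step :: "nat list \<Rightarrow> nat list \<Rightarrow> bool" where
  inner: "d \<ge> 3 \<Longrightarrow> carry_step (xs @ e # d # ys) (xs @ (e + 2) # (d - 3) # ys)"
| front: "d \<ge> 3 \<Longrightarrow> carry_step (d # ys) (2 # (d - 3) # ys)"

text \<open>
  Carrying from right to left. The list is least significant digit first, and the first argument
  is the amount carried into its first position. The theorem \<open>carry_all_iff\<close> below shows that
  performing single carries in any order gives the same result.
\<close>

function carry_from :: "nat \<Rightarrow> nat list \<Rightarrow> nat list" where
  "carry_from c (d # ds) = (c + d) mod 3 # carry_from (2 * ((c + d) div 3)) ds"
| "carry_from c [] = (if c = 0 then [] else c mod 3 # carry_from (2 * (c div 3)) [])"
  by pat_completeness auto
termination
  by (relation "measures [\<lambda>(c, ds). length ds, \<lambda>(c, ds). c]") auto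

definition carry_all :: "nat list \<Rightarrow> nat list" where
  "carry_all ds = rev (carry_from 0 (rev ds))"

lemma carry_from_inner:
  assumes "d \<ge> 3"
  shows "carry_from c (xs @ d # e # ys) = carry_from c (xs @ (d - 3) # (e + 2) # ys)"
proof (induction xs arbitrary: c)
  case Nil
  have "c + d = (c + (d - 3)) + 3" using assms by simp
  then have "(c + d) mod 3 = (c + (d - 3)) mod 3" "(c + d) div 3 = (c + (d - 3)) div 3 + 1"
    by (metis mod_add_self2, metis div_add_self2 zero_neq_numeral)
  then show ?case by (simp add: algebra_simps)
qed simp

lemma carry_from_front:
  assumes "d \<ge> 3"
  shows "carry_from c (xs @ [d]) = carry_from c (xs @ [d - 3, 2])"
proof (induction xs arbitrary: c)
  case Nil
  have "c + d = (c + (d - 3)) + 3" using assms by simp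
  then have "(c + d) mod 3 = (c + (d - 3)) mod 3" "(c + d) div 3 = (c + (d - 3)) div 3 + 1"
    by (metis mod_add_self2, metis div_add_self2 zero_neq_numeral)
  then show ?case by (simp add: algebra_simps)
qed simp

lemma carry_all_step: "carry_step x y \<Longrightarrow> carry_all x = carry_all y"
  by (induction rule: carry_step.induct)
    (simp_all add: carry_all_def carry_from_inner carry_from_front)

lemma carry_all_steps: "carry_step\<^sup>*\<^sup>* x y \<Longrightarrow> carry_all x = carry_all y"
  by (induction rule: rtranclp_induct) (auto dest: carry_all_step)

lemma carry_all_normal: "set x \<subseteq> {0, 1, 2} \<Longrightarrow> carry_all x = x"
proof -
  have "set ds \<subseteq> {0, 1, 2} \<Longrightarrow> carry_from 0 ds = ds" for ds
    by (induction ds) auto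
  then show "set x \<subseteq> {0, 1, 2} \<Longrightarrow> carry_all x = x"
    by (simp add: carry_all_def)
qed

lemma carry_step_sum: "carry_step x y \<Longrightarrow> sum_list y < sum_list x"
  by (induction rule: carry_step.induct) auto

lemma carry_step_exists:
  assumes "\<not> set x \<subseteq> {0, 1, 2}"
  shows "\<exists>y. carry_step x y"
proof -
  obtain d where d: "d \<in> set x" "d \<notin> {0, 1, 2}" using assms by blast
  then have d3: "d \<ge> 3" by auto
  obtain xs ys where x: "x = xs @ d # ys" using d by (meson split_list)
  show ?thesis
  proof (cases xs rule: rev_cases)
    case Nil
    then show ?thesis using x carry_step.front[OF d3, of ys] by auto
  next
    case (snoc zs e)
    then show ?thesis using x carry_step.inner[OF d3, of zs e ys] by auto
  qed
qed

lemma carry_terminates: "\<exists>y. carry_step\<^sup>*\<^sup>* x y \<and> set y \<subseteq> {0, 1, 2}"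
proof (induction "sum_list x" arbitrary: x rule: less_induct)
  case less
  show ?case
  proof (cases "set x \<subseteq> {0, 1, 2}")
    case False
    then obtain y where "carry_step x y" using carry_step_exists by blast
    then show ?thesis
      using less[OF carry_step_sum, of y] by (meson converse_rtranclp_into_rtranclp)
  qed blast
qed

theorem carry_all_iff:
  "carry_step\<^sup>*\<^sup>* x y \<and> set y \<subseteq> {0, 1, 2} \<longleftrightarrow> y = carry_all x"
  by (metis carry_all_normal carry_all_steps carry_terminates)

definition add32 :: "nat list \<Rightarrow> nat list \<Rightarrow> nat list" where
  "add32 xs ys = drop_zeros (carry_all (digitwise_add xs ys))"

definition sort_digits :: "nat list \<Rightarrow> nat list" where
  "sort_digits ds = drop_zeros (sort ds)"

definition sorted_fibs :: "(nat \<Rightarrow> nat list) \<Rightarrow> bool" where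
  "sorted_fibs f \<longleftrightarrow> numeral32 (f 0) \<and> numeral32 (f 1) \<and>
    (\<forall>n\<ge>1. f (n + 1) = sort_digits (add32 (f (n - 1)) (f n)))"

fun pinocchio :: "nat \<Rightarrow> nat list" where
  "pinocchio 0 = []"
| "pinocchio (Suc 0) = [1]"
| "pinocchio (Suc (Suc n)) = sort_digits (add32 (pinocchio n) (pinocchio (Suc n)))"

lemma sorted_fibs_pinocchio: "sorted_fibs pinocchio"
proof -
  have "pinocchio (n + 1) = sort_digits (add32 (pinocchio (n - 1)) (pinocchio n))"
    if "n \<ge> 1" for n
    using that by (cases n) auto
  then show ?thesis by (simp add: sorted_fibs_def numeral32_def)
qed

lemma pinocchio_initial:
  "map pinocchio [0..<10] =
    [[], [1], [1], [2], [2], [1,2], [1,2], [1,1,2], [1,1,2], [1,1,1,2]]"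
  by code_simp

end

theory Submission
  imports Defs "HOL-Library.Multiset"
begin

text \<open>
  A sorted string is determined by the number of its ones and the number of its twos, so the
  sequence is a recurrence on pairs of counts. Read from the right, the column sums of two sorted
  strings form a block of fours, then threes, then twos, then ones. On each block the carry is
  constant after a column or two, so the digits of the sum, and hence the counts of the next term,
  can be read off from the four block lengths (\<open>fib_step_columns\<close>). Let \<open>b\<close> and \<open>d\<close> be the
  numbers of twos of two consecutive terms and \<open>m\<close> the smaller of them.

  If \<open>m \<ge> 2\<close>, the next term has \<open>m\<close> or \<open>m - 1\<close> twos (\<open>fib_step_many_twos\<close>), and \<open>m - 1\<close> if
  the two terms are equal (\<open>fib_step_same_string\<close>). If the number of twos stays at \<open>m\<close>, the
  terms all become the string with a single one and \<open>m\<close> twos; the next sum then loses a two. So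
  the number of twos cannot stay constant and an induction on it works
  (\<open>settles_close_twos\<close>), down to one or two twos. One two in each term leads into the Pinocchio
  sequence, two twos in each lead into the cycle.

  If \<open>m \<le> 1\<close>, the number of twos can jump up. But the jump is limited by the ones of the term with
  few twos and by the twos of the other term. This bound is enough to lead, within a few steps, to a
  pair of terms with twos in which the later term has at most as many twos as the earlier one
  (\<open>settles_fewer_twos\<close>), from which the numbers of twos come close to each other.
\<close>

section \<open>One step of the recurrence on sorted strings\<close>

definition runs :: "nat \<Rightarrow> nat \<Rightarrow> nat list" where
  "runs a b = replicate a 1 @ replicate b 2"

definition fib_step :: "nat list \<Rightarrow> nat list \<Rightarrow> nat list" where
  "fib_step x y = sort_digits (add32 x y)"

text \<open>
  Two lists with the same digits have the same sorting, so the sorted string depends on the digit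
  counts only. It makes the order in which the sum produces its digits irrelevant.
\<close>

lemma drop_zeros_sort:
  assumes "set ds \<subseteq> {0, 1, 2}"
  shows "drop_zeros (sort ds) = runs (count_list ds 1) (count_list ds 2)"
proof -
  let ?r = "replicate (count_list ds 0) 0 @ runs (count_list ds 1) (count_list ds 2)"
  have "count (mset ?r) x = count (mset ds) x" for x
    using assms by (cases "x \<in> {0, 1, 2}") (auto simp: runs_def count_list_0_iff simp flip: count_mset)
  then have "mset ?r = mset ds" by (simp add: multiset_eq_iff)
  moreover have "sorted ?r" by (auto simp: runs_def sorted_append)
  ultimately have "sort ds = ?r" by (rule properties_for_sort)
  moreover have "dropWhile (\<lambda>d. d = 0) (runs p q) = runs p q" for p q
    by (cases p; cases q) (simp_all add: runs_def)
  ultimately show ?thesis by (simp add: drop_zeros_def dropWhile_append)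
qed

lemma sorted_numeral_eq_runs:
  assumes "numeral32 ds" "sorted ds"
  shows "\<exists>a b. ds = runs a b"
proof -
  have "drop_zeros (sort ds) = ds"
    unfolding sorted_sort_id[OF assms(2)] using assms(1)
    by (cases ds) (auto simp: numeral32_def drop_zeros_def)
  then show ?thesis using drop_zeros_sort[of ds] assms by (metis numeral32_def)
qed

lemma carry_from_digits: "set (carry_from c ds) \<subseteq> {0, 1, 2}"
  by (induction c ds rule: carry_from.induct) auto

lemma count_list_drop_zeros: "v \<noteq> 0 \<Longrightarrow> count_list (drop_zeros ds) v = count_list ds v"
  by (induction ds) (auto simp: drop_zeros_def)

lemma fib_step_counts:
  fixes x y
  defines "r \<equiv> carry_from 0 (rev (digitwise_add x y))"
  shows "fib_step x y = runs (count_list r 1) (count_list r 2)"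
proof -
  have r: "add32 x y = drop_zeros (rev r)" by (simp add: add32_def carry_all_def r_def)
  have "set r \<subseteq> {0, 1, 2}" unfolding r_def by (rule carry_from_digits)
  then have "set (drop_zeros (rev r)) \<subseteq> {0, 1, 2}"
    unfolding drop_zeros_def by (metis set_dropWhileD set_rev subset_iff)
  then show ?thesis
    by (simp add: fib_step_def sort_digits_def r drop_zeros_sort count_list_drop_zeros)
qed

text \<open>
  The carries 0, 2 and 4 are fixed by the columns that occur below: a carry \<open>c\<close> and a column \<open>v\<close>
  send \<open>2 * ((c + v) div 3)\<close> to the left, which is again \<open>c\<close> in each of these cases. Such a block of
  equal columns therefore produces a block of equal digits.
\<close>

lemma carry_through_fours: "carry_from 4 (replicate n 4 @ ds) = replicate n 2 @ carry_from 4 ds"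
  and carry_through_threes: "carry_from 4 (replicate n 3 @ ds) = replicate n 1 @ carry_from 4 ds"
  and carry_through_twos: "carry_from 4 (replicate n 2 @ ds) = replicate n 0 @ carry_from 4 ds"
  and small_carry_through_threes:
    "carry_from 2 (replicate n 3 @ ds) = replicate n 2 @ carry_from 2 ds"
  and small_carry_through_twos:
    "carry_from 2 (replicate n 2 @ ds) = replicate n 1 @ carry_from 2 ds"
  and small_carry_through_ones:
    "carry_from 2 (replicate n 1 @ ds) = replicate n 0 @ carry_from 2 ds"
  and no_carry_through_twos:
    "carry_from 0 (replicate n 2 @ ds) = replicate n 2 @ carry_from 0 ds"
  and no_carry_through_ones:
    "carry_from 0 (replicate n 1 @ ds) = replicate n 1 @ carry_from 0 ds"
  by (induction n) simp_all

lemmas carry_through_runs = carry_through_fours carry_through_threes carry_through_twos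
  small_carry_through_threes small_carry_through_twos small_carry_through_ones
  no_carry_through_twos no_carry_through_ones

text \<open>
  The sorted string that results from \<open>s\<close> fours, \<open>r\<close> threes, \<open>q\<close> twos and \<open>p\<close> ones as column
  sums, from right to left. The carry at the end of the fours is 0, 2 or 4 for \<open>s = 0\<close>, \<open>s = 1\<close> or
  \<open>s \<ge> 2\<close>. With carry 4 the block of twos becomes zeros. The first column sum below two, if there is
  one, then reduces the carry to 2: this is the distinction between \<open>p = 0\<close>, where the two
  leading digits are 2 and 1, and \<open>p > 0\<close>.
\<close>

fun carried :: "nat \<Rightarrow> nat \<Rightarrow> nat \<Rightarrow> nat \<Rightarrow> nat list" where
  "carried 0 0 q p = runs p q"
| "carried 0 (Suc r) q p = runs q (Suc r)"
| "carried (Suc 0) r q p = runs (Suc q) (Suc r)"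
| "carried (Suc (Suc s)) r q 0 = runs (r + 2) (Suc s)"
| "carried (Suc (Suc s)) r q (Suc p) = runs (Suc r) (Suc (Suc s))"

lemma count_list_replicate: "count_list (replicate n x) y = (if x = y then n else 0)"
  by (induction n) auto

lemma fib_step_columns:
  assumes "rev (digitwise_add x y) =
    replicate s 4 @ replicate r 3 @ replicate q 2 @ replicate p 1"
  shows "fib_step x y = carried s r q p"
proof -
  define c where "c = carry_from 0 (rev (digitwise_add x y))"
  have "runs (count_list c 1) (count_list c 2) = carried s r q p"
    unfolding c_def assms
    by (cases "(s, r, q, p)" rule: carried.cases)
      (simp_all add: carry_through_runs carry_through_runs[where ds = "[]", simplified]
        count_list_replicate)
  then show ?thesis by (simp add: fib_step_counts c_def)
qed

lemma digitwise_add_commute: "digitwise_add x y = digitwise_add y x"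
  unfolding digitwise_add_def by (subst zip_commute) (auto simp: add.commute)

lemma fib_step_commute: "fib_step x y = fib_step y x"
  by (simp add: fib_step_counts digitwise_add_commute)

text \<open>
  Strings are aligned at the right, so columns are indexed after reversal.
\<close>

lemma rev_digitwise_add_nth:
  assumes "i < max (length x) (length y)"
  shows "rev (digitwise_add x y) ! i =
    (if i < length x then rev x ! i else 0) + (if i < length y then rev y ! i else 0)"
proof -
  have "rev (digitwise_add x y) = map2 (+) (rev (pad (length y) x)) (rev (pad (length x) y))"
    unfolding digitwise_add_def by (subst zip_rev) (simp_all add: pad_def rev_map)
  then show ?thesis using assms by (auto simp: pad_def nth_append)
qed

lemma length_digitwise_add: "length (digitwise_add x y) = max (length x) (length y)"
  by (auto simp: digitwise_add_def pad_def)

lemma rev_runs_nth: "i < a + b \<Longrightarrow> rev (runs a b) ! i = (if i < b then 2 else 1)"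
  by (auto simp: runs_def nth_append)

lemma length_runs: "length (runs a b) = a + b"
  by (simp add: runs_def)

text \<open>
  The first string has at most as many twos as the second. There are two cases, because columns with
  sum two arise from a two above an empty place if the first string is short, and from two ones if it
  reaches beyond the twos of the second.
\<close>

lemma fib_step_runs_short:
  assumes "a + b \<le> d"
  shows "fib_step (runs a b) (runs c d) = carried b a (d - (a + b)) c"
  using assms
  by (intro fib_step_columns nth_equalityI)
    (auto simp: rev_digitwise_add_nth rev_runs_nth length_digitwise_add length_runs nth_append)

lemma fib_step_runs_long:
  assumes "b \<le> d" "d \<le> a + b"
  shows "fib_step (runs a b) (runs c d) = carried b (d - b)
    (min (a + b) (c + d) - d) (max (a + b) (c + d) - min (a + b) (c + d))"
  using assms
  by (intro fib_step_columns nth_equalityI)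
    (auto simp: rev_digitwise_add_nth rev_runs_nth length_digitwise_add length_runs nth_append)


section \<open>The two possible ends of the sequence\<close>

definition eventually_pinocchio_or_cycle :: "(nat \<Rightarrow> nat list) \<Rightarrow> bool" where
  "eventually_pinocchio_or_cycle f \<longleftrightarrow> (\<exists>N K. \<forall>i. f (N + i) = pinocchio (K + i)) \<or>
    (\<exists>N. \<forall>i. f (N + 3 * i) = [1, 1, 2] \<and>
      f (N + 3 * i + 1) = [1, 1, 2, 2] \<and> f (N + 3 * i + 2) = [1, 1, 2, 2])"

text \<open>
  A property of the pair of starting terms, so that the dynamics can be followed backwards from the
  two attractors by \<open>settles_step\<close>, without reference to a position in a given sequence.
\<close>

definition settles :: "nat list \<Rightarrow> nat list \<Rightarrow> bool" where
  "settles x y \<longleftrightarrow> (\<forall>f. f 0 = x \<longrightarrow> f (Suc 0) = y \<longrightarrow>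
    (\<forall>n. f (Suc (Suc n)) = fib_step (f n) (f (Suc n))) \<longrightarrow> eventually_pinocchio_or_cycle f)"

lemma eventually_pinocchio_or_cycle_shift:
  assumes "eventually_pinocchio_or_cycle (\<lambda>n. f (n + 1))"
  shows "eventually_pinocchio_or_cycle f"
proof -
  consider N K where "\<forall>i. f (N + i + 1) = pinocchio (K + i)"
    | N where "\<forall>i. f (N + 3 * i + 1) = [1, 1, 2] \<and>
      f (N + 3 * i + 1 + 1) = [1, 1, 2, 2] \<and> f (N + 3 * i + 2 + 1) = [1, 1, 2, 2]"
    using assms unfolding eventually_pinocchio_or_cycle_def by blast
  then show ?thesis
  proof cases
    case 1
    then have "\<forall>i. f ((N + 1) + i) = pinocchio (K + i)" by simp
    then show ?thesis unfolding eventually_pinocchio_or_cycle_def by blast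
  next
    case 2
    then have "\<forall>i. f ((N + 1) + 3 * i) = [1, 1, 2] \<and>
        f ((N + 1) + 3 * i + 1) = [1, 1, 2, 2] \<and> f ((N + 1) + 3 * i + 2) = [1, 1, 2, 2]"
      by (simp add: eval_nat_numeral)
    then show ?thesis unfolding eventually_pinocchio_or_cycle_def by blast
  qed
qed

lemma settles_step:
  assumes z: "fib_step x y = z" and "settles y z"
  shows "settles x y"
  unfolding settles_def
proof (intro allI impI)
  fix f :: "nat \<Rightarrow> nat list"
  assume f: "f 0 = x" "f (Suc 0) = y" "\<forall>n. f (Suc (Suc n)) = fib_step (f n) (f (Suc n))"
  then have "eventually_pinocchio_or_cycle (\<lambda>n. f (n + 1))"
    using assms(2)[unfolded settles_def, rule_format, of "\<lambda>n. f (n + 1)"] f z by simp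
  then show "eventually_pinocchio_or_cycle f" by (rule eventually_pinocchio_or_cycle_shift)
qed

lemma settles_pinocchio: "settles (pinocchio K) (pinocchio (K + 1))"
  unfolding settles_def
proof (intro allI impI)
  fix f :: "nat \<Rightarrow> nat list"
  assume f: "f 0 = pinocchio K" "f (Suc 0) = pinocchio (K + 1)"
    "\<forall>n. f (Suc (Suc n)) = fib_step (f n) (f (Suc n))"
  have "f i = pinocchio (K + i) \<and> f (i + 1) = pinocchio (K + i + 1)" for i
  proof (induction i)
    case 0
    then show ?case using f by simp
  next
    case (Suc i)
    then show ?case using f(3)[rule_format, of i] by (simp add: fib_step_def)
  qed
  then have "\<forall>i. f (0 + i) = pinocchio (K + i)" by simp
  then show "eventually_pinocchio_or_cycle f" unfolding eventually_pinocchio_or_cycle_def by blast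
qed

lemma fib_step_cycle:
  "fib_step (runs 2 1) (runs 2 2) = runs 2 2"
  "fib_step (runs 2 2) (runs 2 2) = runs 2 1"
  "fib_step (runs 2 2) (runs 2 1) = runs 2 2"
  using fib_step_commute[of "runs 2 2" "runs 2 1"]
  by (simp_all add: fib_step_runs_long eval_nat_numeral)

lemma settles_cycle: "settles (runs 2 1) (runs 2 2)"
  unfolding settles_def
proof (intro allI impI)
  fix f :: "nat \<Rightarrow> nat list"
  assume f: "f 0 = runs 2 1" "f (Suc 0) = runs 2 2"
    "\<forall>n. f (Suc (Suc n)) = fib_step (f n) (f (Suc n))"
  have "f (3 * i) = runs 2 1 \<and> f (Suc (3 * i)) = runs 2 2 \<and>
      f (Suc (Suc (3 * i))) = runs 2 2" for i
  proof (induction i)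
    case 0
    then show ?case using f by (simp add: fib_step_cycle[simplified])
  next
    case (Suc i)
    have "3 * Suc i = Suc (Suc (Suc (3 * i)))" by simp
    then show ?case using Suc f(3) by (simp only: fib_step_cycle)
  qed
  moreover have "runs 2 1 = [1, 1, 2]" "runs 2 2 = [1, 1, 2, 2]"
    by (simp_all add: runs_def eval_nat_numeral)
  ultimately have "\<forall>i. f (0 + 3 * i) = [1, 1, 2] \<and>
      f (0 + 3 * i + 1) = [1, 1, 2, 2] \<and> f (0 + 3 * i + 2) = [1, 1, 2, 2]" by simp
  then show "eventually_pinocchio_or_cycle f" unfolding eventually_pinocchio_or_cycle_def by blast
qed


lemma pinocchio_runs:
  "pinocchio (2 * n + 3) = runs n 1 \<and> pinocchio (2 * n + 4) = runs n 1"
proof (induction n)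
  case 0
  have "map pinocchio [0..<10] ! 3 = [2]" "map pinocchio [0..<10] ! 4 = [2]"
    unfolding pinocchio_initial by simp_all
  then show ?case by (simp add: runs_def del: upt_rec_numeral pinocchio.simps)
next
  case (Suc n)
  have "pinocchio (2 * n + 5) = fib_step (pinocchio (2 * n + 3)) (pinocchio (2 * n + 4))"
    by (simp add: fib_step_def eval_nat_numeral)
  also have "\<dots> = runs (Suc n) 1" using Suc by (simp add: fib_step_runs_long)
  finally have 5: "pinocchio (2 * n + 5) = runs (Suc n) 1" .
  have "pinocchio (2 * n + 6) = fib_step (pinocchio (2 * n + 4)) (pinocchio (2 * n + 5))"
    by (simp add: fib_step_def eval_nat_numeral)
  also have "\<dots> = runs (Suc n) 1" using Suc 5 by (simp add: fib_step_runs_long)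
  finally show ?case using 5 by (simp add: eval_nat_numeral)
qed

text \<open>
  The sum of two such strings has one two and one more one than the shorter of them. So after at most
  two steps the later term has exactly one more one than the earlier one, as in the Pinocchio sequence
  at every second place.
\<close>

lemma settles_one_two_each:
  "settles (runs a 1) (runs c 1)"
proof -
  have succ: "settles (runs n 1) (runs (Suc n) 1)" for n
  proof -
    have "2 * n + 4 + 1 = 2 * Suc n + 3" by simp
    then show ?thesis using settles_pinocchio[of "2 * n + 4"]
        pinocchio_runs[of n] pinocchio_runs[of "Suc n"]
      by (simp only:)
  qed
  have next_le: "fib_step (runs a 1) (runs c 1) = runs (Suc (min a c)) 1" for a c
    by (simp add: fib_step_runs_long)
  show ?thesis
  proof (cases "c \<le> a")
    case True
    then have "fib_step (runs a 1) (runs c 1) = runs (Suc c) 1"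
      unfolding next_le by simp
    then show ?thesis using succ by (rule settles_step)
  next
    case False
    then have "fib_step (runs a 1) (runs c 1) = runs (Suc a) 1"
      and "fib_step (runs c 1) (runs (Suc a) 1) = runs (Suc (Suc a)) 1"
      unfolding next_le by simp_all
    then show ?thesis using succ by (metis settles_step)
  qed
qed

section \<open>The number of twos after one step\<close>

lemma fib_step_same_string:
  "fib_step (runs a (Suc (Suc n))) (runs a (Suc (Suc n))) = runs 2 (Suc n)"
  by (simp add: fib_step_runs_long numeral_2_eq_2)

text \<open>
  The strings have different lengths, so there is a column with sum one. It stops the large carry,
  which is what saves the two that is lost when a string is added to itself.
\<close>

lemma fib_step_same_twos:
  assumes "a \<noteq> c"
  shows "fib_step (runs a (Suc (Suc n))) (runs c (Suc (Suc n))) = runs 1 (Suc (Suc n))"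
proof -
  let ?b = "Suc (Suc n)"
  obtain p where p: "max (a + ?b) (c + ?b) - min (a + ?b) (c + ?b) = Suc p"
    using assms by (cases "max (a + ?b) (c + ?b) - min (a + ?b) (c + ?b)") auto
  show ?thesis unfolding fib_step_runs_long[OF order_refl le_add2] p by simp
qed

lemma carried_many_twos:
  "\<exists>e f. carried (Suc (Suc s)) r q p = runs e f \<and> f \<le> Suc (Suc s) \<and> Suc s \<le> f"
proof (cases p)
  case 0
  then show ?thesis by (intro exI[of _ "r + 2"] exI[of _ "Suc s"]) simp
next
  case (Suc p')
  then show ?thesis by (intro exI[of _ "Suc r"] exI[of _ "Suc (Suc s)"]) simp
qed

text \<open>
  A block of \<open>m\<close> fours leaves \<open>m - 2\<close> twos, and the carry 4 turns no column with sum two or three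
  into a two. The first column with sum one, if there is any, and the last carry give one two each.
\<close>

lemma fib_step_many_twos:
  assumes "b \<ge> 2" "d \<ge> 2"
  shows "\<exists>e f. fib_step (runs a b) (runs c d) = runs e f \<and> f \<le> min b d \<and> min b d \<le> Suc f"
proof -
  \<comment> \<open>The first string may be taken to be the one with fewer twos.\<close>
  have *: "\<exists>e f. fib_step (runs a b) (runs c d) = runs e f \<and> f \<le> b \<and> b \<le> Suc f"
    if le: "b \<le> d" and b: "b \<ge> 2" for a b c d
  proof -
    obtain s where s: "b = Suc (Suc s)" using b by (metis add_2_eq_Suc le_Suc_ex)
    show ?thesis
    proof (cases "a + b \<le> d")
      case True
      show ?thesis unfolding fib_step_runs_short[OF True] using carried_many_twos by (simp add: s)
    next
      case False
      then have d: "d \<le> a + b" by simp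
      show ?thesis unfolding fib_step_runs_long[OF le d] using carried_many_twos by (simp add: s)
    qed
  qed
  show ?thesis
  proof (cases "b \<le> d")
    case True
    then show ?thesis using *[OF True assms(1)] by (simp add: min_absorb1)
  next
    case False
    then show ?thesis using *[of d b c a] assms(2)
      by (simp add: min_absorb2 fib_step_commute[of "runs a b"])
  qed
qed

text \<open>
  After the single four the carry is 2. It turns the threes, of which there are \<open>min a (d - 1)\<close>, into
  twos, and the columns to their left into ones and zeros; the last carry gives one more two.
\<close>

lemma fib_step_one_two:
  assumes "d \<ge> 1"
  shows "\<exists>e. fib_step (runs a 1) (runs c d) = runs e (Suc (min a (d - 1)))"
proof (cases "a + 1 \<le> d")
  case True
  then show ?thesis by (auto simp: fib_step_runs_short min_absorb1)
next
  case False
  then show ?thesis using assms by (auto simp: fib_step_runs_long min_absorb2)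
qed

text \<open>
  The threes, of which there are \<open>min a d\<close>, give a zero at the right and twos elsewhere; the last
  carry makes up for the zero.
\<close>

lemma fib_step_no_twos:
  assumes "a \<ge> 1" "d \<ge> 1"
  shows "\<exists>e. fib_step (runs a 0) (runs c d) = runs e (min a d)"
proof (cases "a \<le> d")
  case True
  then obtain r where "a = Suc r" using assms by (cases a) auto
  then show ?thesis using True by (auto simp: fib_step_runs_short min_absorb1)
next
  case False
  then obtain r where "d = Suc r" using assms by (cases d) auto
  then show ?thesis using False by (auto simp: fib_step_runs_long min_absorb2)
qed

lemma fib_step_only_ones: "\<exists>e. fib_step (runs a 0) (runs c 0) = runs e (min a c)"
  by (auto simp: fib_step_runs_long)

lemma fib_step_empty: "fib_step (runs 0 0) (runs c d) = runs c d"
  by (simp add: fib_step_runs_short)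

section \<open>Every pair of sorted strings settles\<close>

text \<open>
  The sum of strings with equally many twos but different numbers of ones has a single one and the same
  number of twos. After at most one more such step both terms of the pair are this string, and only
  then is a two lost. The assumption is about the pair reached in this way.
\<close>

lemma settles_equal_twos:
  assumes next_settles: "settles (runs 1 (Suc (Suc n))) (runs 2 (Suc n))"
    and "a \<noteq> c"
  shows "settles (runs a (Suc (Suc n))) (runs c (Suc (Suc n)))"
proof -
  have one: "settles (runs 1 (Suc (Suc n))) (runs 1 (Suc (Suc n)))"
    by (rule settles_step[OF fib_step_same_string next_settles])
  have "settles (runs c (Suc (Suc n))) (runs 1 (Suc (Suc n)))"
  proof (cases "c = 1")
    case True
    then show ?thesis using one by simp
  next
    case False
    show ?thesis by (rule settles_step[OF fib_step_same_twos[OF False] one])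
  qed
  then show ?thesis by (rule settles_step[OF fib_step_same_twos[OF \<open>a \<noteq> c\<close>]])
qed

lemma settles_same_string:
  assumes "settles (runs a (Suc (Suc n))) (runs 2 (Suc n))"
  shows "settles (runs a (Suc (Suc n))) (runs a (Suc (Suc n)))"
  by (rule settles_step[OF fib_step_same_string assms])

text \<open>
  Every pair with two twos in each term enters the cycle. If the terms differ, \<open>settles_equal_twos\<close>
  leads to \<open>122, 112\<close>; if they are equal, the sum is 112. The pair \<open>22, 112\<close> is the exception where
  the next term is not yet 1122.
\<close>

lemma settles_two_twos: "settles (runs a 2) (runs c 2)"
proof -
  have pos: "settles (runs a 2) (runs 2 1)" if "a \<ge> 1" for a
  proof -
    have "fib_step (runs 2 1) (runs a 2) = runs 2 2"
      using that by (simp add: fib_step_runs_long eval_nat_numeral)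
    then have "fib_step (runs a 2) (runs 2 1) = runs 2 2"
      by (simp only: fib_step_commute[of "runs a 2"])
    then show ?thesis by (rule settles_step[OF _ settles_cycle])
  qed
  have diff: "settles (runs a 2) (runs c 2)" if "a \<noteq> c" for a c
    using settles_equal_twos[of 0 a c] pos[of 1] that by (simp add: eval_nat_numeral)
  \<comment> \<open>The terms are 22, 112, 122, 1122, and the last two differ in their ones only.\<close>
  have zero: "settles (runs 0 2) (runs 2 1)"
  proof -
    have "fib_step (runs 2 1) (runs 0 2) = runs 1 2"
      by (simp add: fib_step_runs_long eval_nat_numeral)
    then have first: "fib_step (runs 0 2) (runs 2 1) = runs 1 2"
      by (simp only: fib_step_commute[of "runs 0 2"])
    have second: "fib_step (runs 2 1) (runs 1 2) = runs 2 2"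
      by (simp add: fib_step_runs_long eval_nat_numeral)
    show ?thesis by (rule settles_step[OF first settles_step[OF second diff]]) simp
  qed
  show ?thesis
  proof (cases "a = c")
    case True
    have "settles (runs a 2) (runs 2 1)" using pos[of a] zero by (cases "a = 0") auto
    then show ?thesis using settles_same_string[of a 0] True by (simp add: eval_nat_numeral)
  qed (rule diff)
qed

text \<open>
  The sum has one two if there is no one in the second string, and two twos otherwise. In the second
  case the step after that gives two twos again.
\<close>

lemma settles_two_one: "settles (runs a 2) (runs c 1)"
proof -
  obtain e where "fib_step (runs c 1) (runs a 2) = runs e (Suc (min c 1))"
    using fib_step_one_two[of 2 c a] by auto
  then have e: "fib_step (runs a 2) (runs c 1) = runs e (Suc (min c 1))"
    by (simp only: fib_step_commute[of "runs a 2"])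
  show ?thesis
  proof (cases "c = 0")
    case True
    then show ?thesis using settles_step[OF e] settles_one_two_each[of c e] by simp
  next
    case False
    then have e2: "fib_step (runs a 2) (runs c 1) = runs e 2"
      using e by (simp add: eval_nat_numeral min_absorb2)
    obtain w where "fib_step (runs c 1) (runs e 2) = runs w (Suc (min c 1))"
      using fib_step_one_two[of 2 c e] by auto
    then have w: "fib_step (runs c 1) (runs e 2) = runs w 2"
      using False by (simp add: eval_nat_numeral min_absorb2)
    show ?thesis by (rule settles_step[OF e2 settles_step[OF w settles_two_twos]])
  qed
qed

text \<open>
  The induction is on the number of twos of the later term. The next term has as many twos or one
  less. In the first case, \<open>settles_equal_twos\<close> and \<open>settles_same_string\<close> lead to a pair in which a two
  is lost, and every pair in which a two is lost again satisfies the hypotheses, with smaller \<open>d\<close>.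
\<close>

lemma settles_close_twos:
  assumes "d \<ge> 1" "b = d \<or> b = Suc d"
  shows "settles (runs a b) (runs c d)"
  using assms
proof (induction d arbitrary: a b c rule: less_induct)
  case (less d)
  show ?case
  proof (cases "d = 1")
    case True
    then show ?thesis using less.prems settles_one_two_each settles_two_one
      by (auto simp: numeral_2_eq_2)
  next
    case False
    then obtain n where n: "d = Suc (Suc n)"
      using less.prems by (metis One_nat_def Suc_le_D not0_implies_Suc)
    have fewer: "settles (runs x (Suc (Suc n))) (runs y (Suc n))" for x y
      by (rule less.IH) (auto simp: n)
    have same: "settles (runs x d) (runs y d)" for x y
      unfolding n using settles_equal_twos settles_same_string fewer by (cases "x = y") auto
    obtain e f where ef: "fib_step (runs a b) (runs c d) = runs e f" "f \<le> d" "d \<le> Suc f"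
      using fib_step_many_twos[of b d a c] less.prems n by auto
    then consider "f = d" | "f = Suc n" using n by linarith
    then have "settles (runs c d) (runs e f)" by cases (simp_all add: same[unfolded n] fewer n)
    then show ?thesis by (rule settles_step[OF ef(1)])
  qed
qed

text \<open>
  There are \<open>d - 1\<close> columns with sum three, so the sum has again \<open>d\<close> twos.
\<close>

lemma settles_one_many:
  assumes "2 \<le> d" "d \<le> Suc a"
  shows "settles (runs a 1) (runs c d)"
proof -
  obtain e where "fib_step (runs a 1) (runs c d) = runs e d"
    using fib_step_one_two[of d a c] assms by (auto simp: min_absorb2)
  then show ?thesis by (rule settles_step) (use assms in \<open>simp add: settles_close_twos\<close>)
qed

text \<open>
  For \<open>d \<ge> 2\<close> the numbers of twos are close from the next pair on. For \<open>d = 1\<close> the next term may have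
  many twos, but at most one more than \<open>c\<close>, so that \<open>settles_one_many\<close> applies.
\<close>

lemma settles_fewer_twos:
  assumes "1 \<le> d" "d \<le> b"
  shows "settles (runs a b) (runs c d)"
proof (cases "d = 1")
  case False
  obtain e f where ef: "fib_step (runs a b) (runs c d) = runs e f" "f \<le> d" "d \<le> Suc f"
    using fib_step_many_twos[of b d a c] assms False by auto
  have "settles (runs c d) (runs e f)"
    by (rule settles_close_twos) (use ef False assms in auto)
  then show ?thesis by (rule settles_step[OF ef(1)])
next
  case True
  obtain e where "fib_step (runs c 1) (runs a b) = runs e (Suc (min c (b - 1)))"
    using fib_step_one_two assms by force
  then have e: "fib_step (runs a b) (runs c d) = runs e (Suc (min c (b - 1)))"
    by (simp only: fib_step_commute[of "runs a b"] True)
  have "settles (runs c 1) (runs e (Suc (min c (b - 1))))"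
  proof (cases "min c (b - 1) = 0")
    case True
    then show ?thesis using settles_one_two_each by simp
  next
    case False
    show ?thesis by (rule settles_one_many) (use False in auto)
  qed
  then show ?thesis using settles_step[OF e] True by simp
qed

text \<open>
  If the later term has more twos, the next one has at most as many as the later one. So the pair
  after one step is in the case of \<open>settles_fewer_twos\<close>.
\<close>

lemma settles_both_twos:
  assumes "1 \<le> b" "1 \<le> d"
  shows "settles (runs a b) (runs c d)"
proof (cases "d \<le> b")
  case True
  then show ?thesis using settles_fewer_twos assms by blast
next
  case less: False
  show ?thesis
  proof (cases "b = 1")
    case False
    obtain e f where ef: "fib_step (runs a b) (runs c d) = runs e f" "f \<le> b" "b \<le> Suc f"
      using fib_step_many_twos[of b d a c] assms False less by auto
    have "settles (runs c d) (runs e f)"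
      by (rule settles_fewer_twos) (use ef False assms less in auto)
    then show ?thesis by (rule settles_step[OF ef(1)])
  next
    case True
    obtain e where e: "fib_step (runs a 1) (runs c d) = runs e (Suc (min a (d - 1)))"
      using fib_step_one_two[OF assms(2)] by blast
    have "settles (runs c d) (runs e (Suc (min a (d - 1))))"
      by (rule settles_fewer_twos) (use assms in auto)
    then show ?thesis using settles_step[OF e] True by simp
  qed
qed

lemma settles_twos_in_second:
  assumes "1 \<le> a" "1 \<le> d"
  shows "settles (runs a 0) (runs c d)"
proof -
  obtain e where "fib_step (runs a 0) (runs c d) = runs e (min a d)"
    using fib_step_no_twos[OF assms] by blast
  then show ?thesis by (rule settles_step) (use assms in \<open>simp add: settles_both_twos\<close>)
qed

text \<open>
  A term without twos that is not empty contains a one. The next sum therefore has a two, and at most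
  two steps lead to a pair in which both terms have twos.
\<close>

lemma settles_nonempty:
  assumes "runs a b \<noteq> []" "runs c d \<noteq> []"
  shows "settles (runs a b) (runs c d)"
proof -
  have a: "a \<ge> 1" if "b = 0" using assms that by (cases a) (auto simp: runs_def)
  have c: "c \<ge> 1" if "d = 0" using assms that by (cases c) (auto simp: runs_def)
  show ?thesis
  proof (cases "b = 0"; cases "d = 0")
    assume "b \<noteq> 0" "d \<noteq> 0"
    then show ?thesis by (simp add: settles_both_twos)
  next
    assume "b = 0" "d \<noteq> 0"
    then show ?thesis using a by (simp add: settles_twos_in_second)
  next
    assume bd: "b \<noteq> 0" "d = 0"
    then obtain e where "fib_step (runs c 0) (runs a b) = runs e (min c b)"
      using fib_step_no_twos[of c b a] c by auto
    then have "fib_step (runs a b) (runs c d) = runs e (min c b)"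
      by (simp add: fib_step_commute[of "runs a b"] bd)
    then show ?thesis by (rule settles_step) (use bd c in \<open>simp add: settles_twos_in_second\<close>)
  next
    assume bd: "b = 0" "d = 0"
    obtain e where "fib_step (runs a 0) (runs c 0) = runs e (min a c)"
      using fib_step_only_ones by blast
    then have "fib_step (runs a b) (runs c d) = runs e (min a c)" by (simp add: bd)
    then show ?thesis by (rule settles_step) (use bd a c in \<open>simp add: settles_twos_in_second\<close>)
  qed
qed

text \<open>
  An empty term adds nothing, so it is followed by two equal nonempty terms.
\<close>

lemma settles_runs:
  assumes "runs a b \<noteq> [] \<or> runs c d \<noteq> []"
  shows "settles (runs a b) (runs c d)"
proof -
  have empty: "runs 0 0 = []" by (simp add: runs_def)
  have left: "settles [] (runs c d)" if "runs c d \<noteq> []" for c d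
    by (rule settles_step[OF fib_step_empty[unfolded empty] settles_nonempty[OF that that]])
  have right: "settles (runs a b) []" if "runs a b \<noteq> []" for a b
    by (rule settles_step[OF _ left[OF that]])
      (metis fib_step_commute fib_step_empty empty)
  show ?thesis using assms left right settles_nonempty by metis
qed

theorem theorem20:
  fixes f :: "nat \<Rightarrow> nat list"
  assumes "sorted_fibs f"
    and "sorted (f 0)"
    and "sorted (f 1)"
    and "\<not> (f 0 = [] \<and> f 1 = [])"
  shows "(\<exists>N K. \<forall>i. f (N + i) = pinocchio (K + i)) \<or>
    (\<exists>N. \<forall>i. f (N + 3 * i) = [1, 1, 2] \<and>
      f (N + 3 * i + 1) = [1, 1, 2, 2] \<and> f (N + 3 * i + 2) = [1, 1, 2, 2])"
proof -
  have f: "numeral32 (f 0)" "numeral32 (f 1)"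
    "\<forall>n\<ge>1. f (n + 1) = fib_step (f (n - 1)) (f n)"
    using assms(1) by (simp_all add: sorted_fibs_def fib_step_def)
  obtain a b c d where "f 0 = runs a b" "f 1 = runs c d"
    using sorted_numeral_eq_runs f assms by meson
  then have "settles (f 0) (f 1)" using settles_runs assms(4) by auto
  moreover have "f (Suc (Suc n)) = fib_step (f n) (f (Suc n))" for n
    using f(3)[rule_format, of "Suc n"] by simp
  ultimately have "eventually_pinocchio_or_cycle f" by (simp add: settles_def)
  then show ?thesis unfolding eventually_pinocchio_or_cycle_def .
qed

end
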